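(* Let $\mathcal C: f=0$ be a reduced curve in $\mathbb P^2$ with $f=q_1q_2\cdots q_m$ for some $m\ge 3$, where $q_1,\dots,q_m$ are homogeneous of degree $k\ge 2$ and the curves $\mathcal C_i: q_i=0$ are members of the pencil $\mathcal P: u\mathcal C_1+v\mathcal C_2$. Assume that $\mathcal P$ has a $0$-dimensional base locus and contains only reduced curves. Then either $mdr(f)=2k-2$, or $m=3$, $mdr(f)\le 2k-3$, and one of the following two cases occurs: (1) $k\ge 4$ and $mdr(f)\le k+1$; then $mdr(f)=k+1$ and $\mathcal C$ is free with exponents $d_1=k+1$, $d_2=2k-2$; (2) $k\ge 5$ and $k+2\le mdr(f)\le 2k-3$.
   Context: The pencil $u\mathcal C_1+v\mathcal C_2$ consists of the curves $uq_1+vq_2=0$, $(u:v)\in\mathbb P^1$. $mdr(f)$ is the smallest $r\ge 0$ such that $af_x+bf_y+cf_z=0$ for some homogeneous $a,b,c$ of degree $r$, not all zero. The curve is free with exponents $d_1\le d_2$ if $AR(f)=\{(a,b,c)\in\mathbb C[x,y,z]^3: af_x+bf_y+cf_z=0\}$ is a free module with homogeneous basis of degrees $d_1,d_2$. *)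

theory Defs
  imports "HOL-Computational_Algebra.Polynomial" "HOL-Computational_Algebra.Squarefree"
begin

text \<open>Polynomials in C[x,y,z], represented as nested univariate polynomials
  C[x][y][z]: the outer variable is z, then y, innermost x.\<close>
type_synonym cpoly3 = "complex poly poly poly"

definition coeff3 :: "cpoly3 \<Rightarrow> nat \<Rightarrow> nat \<Rightarrow> nat \<Rightarrow> complex" where
  "coeff3 f i j l = coeff (coeff (coeff f l) j) i"

definition homog :: "cpoly3 \<Rightarrow> nat \<Rightarrow> bool" where
  "homog f d \<longleftrightarrow> (\<forall>i j l. coeff3 f i j l \<noteq> 0 \<longrightarrow> i + j + l = d)"

definition const3 :: "complex \<Rightarrow> cpoly3" where
  "const3 c = [:[:[:c:]:]:]"

definition eval3 :: "cpoly3 \<Rightarrow> complex \<Rightarrow> complex \<Rightarrow> complex \<Rightarrow> complex" where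
  "eval3 f a b c = poly (map_poly (\<lambda>g. poly (map_poly (\<lambda>h. poly h a) g) b) f) c"

definition dx :: "cpoly3 \<Rightarrow> cpoly3" where "dx f = map_poly (map_poly pderiv) f"
definition dy :: "cpoly3 \<Rightarrow> cpoly3" where "dy f = map_poly pderiv f"
definition dz :: "cpoly3 \<Rightarrow> cpoly3" where "dz f = pderiv f"

definition syz :: "cpoly3 \<Rightarrow> cpoly3 \<times> cpoly3 \<times> cpoly3 \<Rightarrow> bool" where
  "syz f r = (case r of (a, b, c) \<Rightarrow> a * dx f + b * dy f + c * dz f = 0)"

definition homog_triple :: "cpoly3 \<times> cpoly3 \<times> cpoly3 \<Rightarrow> nat \<Rightarrow> bool" where
  "homog_triple r d = (case r of (a, b, c) \<Rightarrow> homog a d \<and> homog b d \<and> homog c d)"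

definition mdr :: "cpoly3 \<Rightarrow> nat" where
  "mdr f = (LEAST r. \<exists>t. homog_triple t r \<and> t \<noteq> (0, 0, 0) \<and> syz f t)"

definition tcomb :: "cpoly3 \<Rightarrow> cpoly3 \<times> cpoly3 \<times> cpoly3 \<Rightarrow> cpoly3 \<Rightarrow> cpoly3 \<times> cpoly3 \<times> cpoly3
    \<Rightarrow> cpoly3 \<times> cpoly3 \<times> cpoly3" where
  "tcomb p1 r1 p2 r2 = (case r1 of (a1, b1, c1) \<Rightarrow> case r2 of (a2, b2, c2) \<Rightarrow>
      (p1 * a1 + p2 * a2, p1 * b1 + p2 * b2, p1 * c1 + p2 * c2))"

definition free_with_exponents :: "cpoly3 \<Rightarrow> nat \<Rightarrow> nat \<Rightarrow> bool" where
  "free_with_exponents f d1 d2 \<longleftrightarrow>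
     (\<exists>r1 r2. homog_triple r1 d1 \<and> homog_triple r2 d2 \<and> syz f r1 \<and> syz f r2 \<and>
        (\<forall>r. syz f r \<longrightarrow> (\<exists>!p. r = tcomb (fst p) r1 (snd p) r2)))"

text \<open>base locus of the pencil spanned by q1, q2 is 0-dimensional: finitely many
  points of P^2, i.e. the nonzero common zeros lie on finitely many lines through 0\<close>
definition zero_dim_base_locus :: "cpoly3 \<Rightarrow> cpoly3 \<Rightarrow> bool" where
  "zero_dim_base_locus q1 q2 \<longleftrightarrow>
     (\<exists>S :: (complex \<times> complex \<times> complex) set. finite S \<and>
        (\<forall>a b c. (a, b, c) \<noteq> (0, 0, 0) \<and> eval3 q1 a b c = 0 \<and> eval3 q2 a b c = 0 \<longrightarrow>
           (\<exists>(a', b', c') \<in> S. \<exists>t. a = t * a' \<and> b = t * b' \<and> c = t * c')))"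

end

theory Submission
  imports Defs "HOL-Computational_Algebra.Polynomial_Factorial" "HOL-Computational_Algebra.Field_as_Ring"
    "HOL-Computational_Algebra.Fundamental_Theorem_Algebra"
begin

text \<open>The cross product X of the gradients of two members of the pencil is a syzygy of degree 2k - 2.
  Its components have no common prime factor p. Otherwise the derivation h \<mapsto> det(dp, dq1, dh)
  annihilates p, q1 and q2 modulo p, and differentiating an algebraic relation modulo p between q1, q2
  and a variable shows that q1 and q2 are algebraically dependent modulo p; as they are homogeneous of
  equal degree, p divides a member g of the pencil. Euler's identity then makes p divide dg, so that
  the square of p divides g, although all members are reduced.

  Hence a syzygy t of degree r < 2k - 2 is not parallel to X. As the gradient of the squarefree f is
  primitive, the cross product of t and X is s df with s nonzero, and comparing degrees
  gives mk - 1 \<le> r + 2k - 2. This forces m = 3 and r \<ge> k + 1. For r = k + 1 the factor s is a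
  constant, which makes t and X a basis of all syzygies (Saito's criterion).\<close>

subsection \<open>Derivations\<close>

definition derivation :: "('a::comm_ring_1 \<Rightarrow> 'a) \<Rightarrow> bool" where
  "derivation d \<longleftrightarrow> (\<forall>a b. d (a + b) = d a + d b) \<and> (\<forall>a b. d (a * b) = a * d b + d a * b)"

lemma derivation_add: "derivation d \<Longrightarrow> d (a + b) = d a + d b"
  and derivation_mult: "derivation d \<Longrightarrow> d (a * b) = a * d b + d a * b"
  by (simp_all add: derivation_def)

lemma derivation_0: "derivation d \<Longrightarrow> d 0 = 0"
  using derivation_add[of d 0 0] by simp

lemma derivation_sum: "derivation d \<Longrightarrow> d (sum g A) = (\<Sum>x\<in>A. d (g x))"
  by (induction A rule: infinite_finite_induct) (simp_all add: derivation_0 derivation_add)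

lemma derivation_1: "derivation d \<Longrightarrow> d 1 = 0"
  using derivation_mult[of d 1 1] by simp

lemma derivation_prod_0:
  assumes "derivation d" "\<And>x. x \<in> A \<Longrightarrow> d (g x) = 0"
  shows "d (prod g A) = 0"
  using assms(2)
  by (induction A rule: infinite_finite_induct) (simp_all add: derivation_1 derivation_mult assms(1))

lemma derivation_pderiv: "derivation (pderiv :: 'a::idom poly \<Rightarrow> 'a poly)"
  by (simp add: derivation_def pderiv_add pderiv_mult mult.commute)

text \<open>The partial derivatives in the inner variables act coefficientwise on the outer ones.
  The product rule survives because each coefficient of a product is a finite sum of products of
  coefficients.\<close>

lemma derivation_map_poly:
  assumes "derivation d" shows "derivation (map_poly d)"
  unfolding derivation_def
  by (auto simp: poly_eq_iff coeff_map_poly derivation_0[OF assms] coeff_mult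
      derivation_sum[OF assms] derivation_add[OF assms] derivation_mult[OF assms] sum.distrib)

lemma derivation_lin_comb:
  assumes "derivation d1" "derivation d2" "derivation d3"
  shows "derivation (\<lambda>f. a * d1 f + b * d2 f + c * d3 f)"
  unfolding derivation_def
  by (auto simp: derivation_add[OF assms(1)] derivation_add[OF assms(2)] derivation_add[OF assms(3)]
      derivation_mult[OF assms(1)] derivation_mult[OF assms(2)] derivation_mult[OF assms(3)] algebra_simps)

lemma derivation_dx: "derivation dx" and derivation_dy: "derivation dy" and derivation_dz: "derivation dz"
proof -
  have "dx = map_poly (map_poly pderiv)" "dy = map_poly pderiv" "dz = pderiv"
    by (auto simp: dx_def dy_def dz_def fun_eq_iff)
  then show "derivation dx" "derivation dy" "derivation dz"
    by (metis derivation_map_poly derivation_pderiv)+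
qed

text \<open>Chain rule modulo p: the derivative of F(w) is F'(w) D w plus the value at w of F with D
  applied to its coefficients, and p divides the latter part.\<close>

lemma poly_derivation_cong:
  fixes F :: "'a::idom poly"
  assumes D: "derivation D" and F: "\<And>n. p dvd D (coeff F n)"
  shows "p dvd D (poly F w) - poly (pderiv F) w * D w"
  using F
proof (induction F)
  case 0
  then show ?case by (simp add: derivation_0[OF D])
next
  case (pCons a F)
  have a: "p dvd D a" using pCons.prems[of 0] by simp
  have "p dvd D (coeff F n)" for n using pCons.prems[of "Suc n"] by simp
  then have IH: "p dvd D (poly F w) - poly (pderiv F) w * D w" by (rule pCons.IH)
  have "D (poly (pCons a F) w) - poly (pderiv (pCons a F)) w * D w
      = D a + w * (D (poly F w) - poly (pderiv F) w * D w)"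
    by (simp add: derivation_add[OF D] derivation_mult[OF D] pderiv_pCons algebra_simps)
  then show ?case using a IH by (simp add: dvd_add dvd_mult)
qed

subsection \<open>Homogeneous polynomials in three variables\<close>

definition vx :: cpoly3 where "vx = [:[:[:0, 1:]:]:]"
definition vy :: cpoly3 where "vy = [:[:0, 1:]:]"
definition vz :: cpoly3 where "vz = [:0, 1:]"

definition term3 :: "complex \<Rightarrow> nat \<Rightarrow> nat \<Rightarrow> nat \<Rightarrow> cpoly3" where
  "term3 c i j l = monom (monom (monom c i) j) l"

lemma cpoly3_eqI: "(\<And>i j l. coeff3 f i j l = coeff3 g i j l) \<Longrightarrow> f = g"
  by (simp add: coeff3_def poly_eq_iff)

lemma coeff3_0 [simp]: "coeff3 0 i j l = 0"
  by (simp add: coeff3_def)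

lemma coeff3_add: "coeff3 (f + g) i j l = coeff3 f i j l + coeff3 g i j l"
  by (simp add: coeff3_def)

lemma coeff3_diff: "coeff3 (f - g) i j l = coeff3 f i j l - coeff3 g i j l"
  by (simp add: coeff3_def)

lemma coeff3_sum: "coeff3 (sum F A) i j l = (\<Sum>x\<in>A. coeff3 (F x) i j l)"
  by (simp add: coeff3_def coeff_sum)

lemma coeff3_const3_mult: "coeff3 (const3 c * f) i j l = c * coeff3 f i j l"
  by (simp add: coeff3_def const3_def)

lemma coeff3_term3: "coeff3 (term3 c i' j' l') i j l = (if i = i' \<and> j = j' \<and> l = l' then c else 0)"
  by (auto simp: coeff3_def term3_def)

lemma coeff3_dx: "coeff3 (dx f) i j l = of_nat (Suc i) * coeff3 f (Suc i) j l"
  and coeff3_dy: "coeff3 (dy f) i j l = of_nat (Suc j) * coeff3 f i (Suc j) l"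
  and coeff3_dz: "coeff3 (dz f) i j l = of_nat (Suc l) * coeff3 f i j (Suc l)"
  by (simp_all add: coeff3_def dx_def dy_def dz_def coeff_map_poly coeff_pderiv of_nat_poly
      del: of_nat_Suc)

lemma coeff3_vx_mult: "coeff3 (vx * f) i j l = (case i of 0 \<Rightarrow> 0 | Suc i \<Rightarrow> coeff3 f i j l)"
  and coeff3_vy_mult: "coeff3 (vy * f) i j l = (case j of 0 \<Rightarrow> 0 | Suc j \<Rightarrow> coeff3 f i j l)"
  and coeff3_vz_mult: "coeff3 (vz * f) i j l = (case l of 0 \<Rightarrow> 0 | Suc l \<Rightarrow> coeff3 f i j l)"
  by (simp_all add: coeff3_def vx_def vy_def vz_def coeff_pCons split: nat.splits)

lemma coeff3_mult:
  "coeff3 (f * g) i j l = (\<Sum>l'\<le>l. \<Sum>j'\<le>j. \<Sum>i'\<le>i.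
     coeff3 f i' j' l' * coeff3 g (i - i') (j - j') (l - l'))"
  by (simp add: coeff3_def coeff_mult coeff_sum)

lemma homog_0 [simp]: "homog 0 d"
  by (simp add: homog_def)

lemma homog_mult:
  assumes "homog f a" "homog g b" shows "homog (f * g) (a + b)"
  unfolding homog_def
proof (intro allI impI)
  fix i j l assume "coeff3 (f * g) i j l \<noteq> 0"
  then obtain l' j' i' where *: "l' \<le> l" "j' \<le> j" "i' \<le> i"
    and "coeff3 f i' j' l' * coeff3 g (i - i') (j - j') (l - l') \<noteq> 0"
    unfolding coeff3_mult by (metis (no_types, lifting) atMost_iff sum.not_neutral_contains_not_neutral)
  then have "coeff3 f i' j' l' \<noteq> 0" "coeff3 g (i - i') (j - j') (l - l') \<noteq> 0" by auto
  then have "i' + j' + l' = a" "(i - i') + (j - j') + (l - l') = b"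
    using assms unfolding homog_def by blast+
  then show "i + j + l = a + b" using * by linarith
qed

lemma homog_add: "homog f d \<Longrightarrow> homog g d \<Longrightarrow> homog (f + g) d"
  unfolding homog_def coeff3_add by (metis add.right_neutral)

lemma homog_diff: "homog f d \<Longrightarrow> homog g d \<Longrightarrow> homog (f - g) d"
  unfolding homog_def coeff3_diff by (metis diff_zero)

lemma homog_const3: "homog (const3 c) 0"
  by (auto simp: homog_def coeff3_def const3_def coeff_pCons split: nat.splits)

lemma const3_mult: "const3 (a * b) = const3 a * const3 b"
  and const3_add: "const3 (a + b) = const3 a + const3 b"
  and const3_0 [simp]: "const3 0 = 0" and const3_1 [simp]: "const3 1 = 1"
  and const3_minus: "const3 (- a) = - const3 a"
  and const3_of_nat: "const3 (of_nat n) = of_nat n"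
  by (simp_all add: const3_def of_nat_poly one_pCons)

lemma const3_eq_0_iff [simp]: "const3 c = 0 \<longleftrightarrow> c = 0"
  by (simp add: const3_def)

lemma is_unit_const3: "c \<noteq> 0 \<Longrightarrow> is_unit (const3 c)"
  by (rule dvdI[of _ _ "const3 (inverse c)"]) (simp flip: const3_mult)

lemma homog_0_imp_const3: "homog f 0 \<Longrightarrow> f = const3 (coeff3 f 0 0 0)"
  by (rule cpoly3_eqI)
    (auto simp: homog_def coeff3_def const3_def coeff_pCons split: nat.splits)

lemma homog_mult_const3: "homog f d \<Longrightarrow> homog (const3 c * f) d"
  using homog_mult[OF homog_const3] by simp

lemma homog_1: "homog 1 0"
  using homog_const3[of 1] by simp

lemma homog_power: "homog f d \<Longrightarrow> homog (f ^ n) (n * d)"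
  by (induction n) (auto simp: homog_1 intro: homog_mult)

lemma homog_prod:
  assumes "finite A" "\<And>x. x \<in> A \<Longrightarrow> homog (g x) d"
  shows "homog (prod g A) (card A * d)"
  using assms by (induction A) (auto simp: homog_1 intro: homog_mult)

lemma homog_dx: "homog f (Suc d) \<Longrightarrow> homog (dx f) d"
  and homog_dy: "homog f (Suc d) \<Longrightarrow> homog (dy f) d"
  and homog_dz: "homog f (Suc d) \<Longrightarrow> homog (dz f) d"
  unfolding homog_def coeff3_dx coeff3_dy coeff3_dz by force+

lemma homog_vx: "homog vx 1" and homog_vy: "homog vy 1" and homog_vz: "homog vz 1"
  by (auto simp: homog_def coeff3_def vx_def vy_def vz_def coeff_pCons split: nat.splits)

text \<open>Each of the operators \<open>vx * dx\<close>, \<open>vy * dy\<close>,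
  \<open>vz * dz\<close> multiplies a monomial by one exponent, and the three exponents add up to
  d.\<close>

lemma euler_homog:
  assumes "homog f d" shows "vx * dx f + vy * dy f + vz * dz f = of_nat d * f"
proof (rule cpoly3_eqI)
  fix i j l
  have "coeff3 (vx * dx f + vy * dy f + vz * dz f) i j l = of_nat (i + j + l) * coeff3 f i j l"
    by (auto simp: coeff3_add coeff3_vx_mult coeff3_vy_mult coeff3_vz_mult coeff3_dx coeff3_dy
        coeff3_dz algebra_simps split: nat.splits)
  also have "\<dots> = coeff3 (of_nat d * f) i j l"
    using assms unfolding coeff3_const3_mult const3_of_nat[symmetric] 
    by (cases "coeff3 f i j l = 0") (auto simp: homog_def)
  finally show "coeff3 (vx * dx f + vy * dy f + vz * dz f) i j l = coeff3 (of_nat d * f) i j l" .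
qed

lemma term3_expansion:
  assumes "\<And>i j l. coeff3 f i j l \<noteq> 0 \<Longrightarrow> i < N \<and> j < N \<and> l < N"
  shows "f = (\<Sum>(i, j, l) \<in> {..<N} \<times> {..<N} \<times> {..<N}. term3 (coeff3 f i j l) i j l)"
proof (rule cpoly3_eqI)
  fix i j l
  have "coeff3 (\<Sum>(i, j, l) \<in> {..<N} \<times> {..<N} \<times> {..<N}. term3 (coeff3 f i j l) i j l) i j l
     = (\<Sum>x \<in> {..<N} \<times> {..<N} \<times> {..<N}. if x = (i, j, l) then coeff3 f i j l else 0)"
    unfolding coeff3_sum by (intro sum.cong) (auto simp: coeff3_term3 split: if_splits)
  also have "\<dots> = coeff3 f i j l" using assms[of i j l] by (auto simp: sum.delta')
  finally show "coeff3 f i j l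
    = coeff3 (\<Sum>(i, j, l) \<in> {..<N} \<times> {..<N} \<times> {..<N}. term3 (coeff3 f i j l) i j l) i j l" ..
qed

lemma coeff3_bounded: "\<exists>N. \<forall>i j l. coeff3 f i j l \<noteq> 0 \<longrightarrow> i < N \<and> j < N \<and> l < N"
proof -
  define A where "A = (\<Union>l\<le>degree f. (\<lambda>j. degree (coeff (coeff f l) j)) ` {..degree (coeff f l)})"
  define B where "B = (\<lambda>l. degree (coeff f l)) ` {..degree f}"
  have fin: "finite A" "finite B" by (auto simp: A_def B_def)
  define N where "N = Suc (Max (insert 0 A) + Max (insert 0 B) + degree f)"
  show ?thesis
  proof (intro exI allI impI)
    fix i j l assume nz: "coeff3 f i j l \<noteq> 0"
    then have l: "l \<le> degree f" by (intro le_degree) (auto simp: coeff3_def)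
    have j: "j \<le> degree (coeff f l)" using nz by (intro le_degree) (auto simp: coeff3_def)
    have i: "i \<le> degree (coeff (coeff f l) j)" using nz by (intro le_degree) (auto simp: coeff3_def)
    have "degree (coeff f l) \<in> B" "degree (coeff (coeff f l) j) \<in> A"
      using l j by (auto simp: A_def B_def)
    then have "degree (coeff f l) \<le> Max (insert 0 B)" "degree (coeff (coeff f l) j) \<le> Max (insert 0 A)"
      using fin by auto
    then show "i < N \<and> j < N \<and> l < N" using i j l by (auto simp: N_def)
  qed
qed

subsection \<open>Homogeneous components\<close>

text \<open>A ring homomorphism on the coefficients and an image c of the variable determine one on
  polynomials. The grading map below is built this way in three stages, one for each nested
  variable.\<close>

lemma map_poly_hom:
  fixes h :: "'a::comm_ring_1 \<Rightarrow> 'b::comm_ring_1"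
  assumes "h 0 = 0" "\<And>a b. h (a + b) = h a + h b" "\<And>a b. h (a * b) = h a * h b"
  shows "poly (map_poly h 0) c = 0"
    and "poly (map_poly h (f + g)) c = poly (map_poly h f) c + poly (map_poly h g) c"
    and "poly (map_poly h (f * g)) c = poly (map_poly h f) c * poly (map_poly h g) c"
    and "poly (map_poly h (monom a n)) c = h a * c ^ n"
proof -
  have add: "map_poly h (f + g) = map_poly h f + map_poly h g" for f g
    by (simp add: poly_eq_iff coeff_map_poly assms)
  have sum: "h (sum F A) = (\<Sum>x\<in>A. h (F x))" for F and A :: "nat set"
    by (induction A rule: infinite_finite_induct) (simp_all add: assms)
  have "map_poly h (f * g) = map_poly h f * map_poly h g"
    by (simp add: poly_eq_iff coeff_map_poly assms coeff_mult sum)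
  then show "poly (map_poly h (f * g)) c = poly (map_poly h f) c * poly (map_poly h g) c" by simp
  show "poly (map_poly h (f + g)) c = poly (map_poly h f) c + poly (map_poly h g) c"
    by (simp add: add)
  show "poly (map_poly h 0) c = 0" by simp
  show "poly (map_poly h (monom a n)) c = h a * c ^ n"
    using assms(1) by (simp add: map_poly_monom poly_monom)
qed

text \<open>The auxiliary variable t is the outermost one of the target ring, so
  \<open>[:0, vx:]\<close> stands for tx.\<close>

definition grading1 :: "complex poly \<Rightarrow> cpoly3 poly" where
  "grading1 h = poly (map_poly (\<lambda>c. [:const3 c:]) h) [:0, vx:]"
definition grading2 :: "complex poly poly \<Rightarrow> cpoly3 poly" where
  "grading2 g = poly (map_poly grading1 g) [:0, vy:]"
text \<open>The ring homomorphism sending f to the polynomial f(tx, ty, tz) in t, whose n-th coefficient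
  is the homogeneous component of f of degree n.\<close>
definition grading :: "cpoly3 \<Rightarrow> cpoly3 poly" where
  "grading f = poly (map_poly grading2 f) [:0, vz:]"

lemma grading1_hom: "grading1 0 = 0" "grading1 (f + g) = grading1 f + grading1 g" "grading1 (f * g) = grading1 f * grading1 g"
  "grading1 (monom c n) = [:const3 c:] * [:0, vx:] ^ n"
  unfolding grading1_def by (rule map_poly_hom; simp add: const3_add const3_mult)+

lemma grading2_hom: "grading2 0 = 0" "grading2 (f + g) = grading2 f + grading2 g" "grading2 (f * g) = grading2 f * grading2 g"
  "grading2 (monom a n) = grading1 a * [:0, vy:] ^ n"
  unfolding grading2_def by (rule map_poly_hom; simp add: grading1_hom)+

lemma grading_hom: "grading 0 = 0" "grading (f + g) = grading f + grading g"
  "grading (f * g) = grading f * grading g" "grading (monom b n) = grading2 b * [:0, vz:] ^ n"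
  unfolding grading_def by (rule map_poly_hom; simp add: grading2_hom)+

lemma term3_eq: "term3 c i j l = const3 c * vx ^ i * vy ^ j * vz ^ l"
proof -
  have vx: "vx ^ i = [:[:monom 1 i:]:]"
    by (simp add: vx_def poly_const_pow monom_altdef)
  have vy: "vy ^ j = [:monom 1 j:]"
    by (simp add: vy_def poly_const_pow monom_altdef)
  have vz: "vz ^ l = monom 1 l"
    by (simp add: vz_def monom_altdef)
  show ?thesis
    by (simp add: vx vy vz const3_def term3_def smult_monom)
qed

lemma grading_term3: "grading (term3 c i j l) = monom (term3 c i j l) (i + j + l)"
proof -
  have pow: "[:0, v:] ^ n = monom (v ^ n) n" for v :: cpoly3 and n
    using smult_power[of v "[:0, 1:]" n] by (simp add: monom_altdef)
  have "grading (term3 c i j l) = [:const3 c:] * [:0, vx:] ^ i * [:0, vy:] ^ j * [:0, vz:] ^ l"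
    by (simp add: term3_def grading_hom grading2_hom grading1_hom)
  also have "\<dots> = monom (term3 c i j l) (i + j + l)"
    by (simp add: term3_eq pow smult_monom mult_monom mult.assoc add.assoc)
  finally show ?thesis .
qed

lemma grading_sum: "grading (sum F A) = (\<Sum>x\<in>A. grading (F x))"
  by (induction A rule: infinite_finite_induct) (simp_all add: grading_hom)

lemma coeff3_grading:
  "coeff3 (coeff (grading f) n) i j l = (if i + j + l = n then coeff3 f i j l else 0)"
proof -
  obtain N where N: "\<And>i j l. coeff3 f i j l \<noteq> 0 \<Longrightarrow> i < N \<and> j < N \<and> l < N"
    using coeff3_bounded[of f] by metis
  let ?B = "{..<N} \<times> {..<N} \<times> {..<N}"
  have "grading f = (\<Sum>x\<in>?B. grading (case x of (i, j, l) \<Rightarrow> term3 (coeff3 f i j l) i j l))"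
    by (subst term3_expansion[OF N]) (simp_all add: grading_sum)
  then have "coeff3 (coeff (grading f) n) i j l
    = (\<Sum>x\<in>?B. coeff3 (coeff (grading (case x of (i, j, l) \<Rightarrow> term3 (coeff3 f i j l) i j l)) n) i j l)"
    by (simp add: coeff_sum coeff3_sum)
  also have "\<dots> = (\<Sum>x\<in>?B. if x = (i, j, l) then if i + j + l = n then coeff3 f i j l else 0 else 0)"
    by (intro sum.cong) (auto simp: grading_term3 coeff3_term3 split: if_splits)
  also have "\<dots> = (if i + j + l = n then coeff3 f i j l else 0)"
    using N[of i j l] by (auto simp: sum.delta')
  finally show ?thesis .
qed

lemma homog_iff_grading: "homog f d \<longleftrightarrow> grading f = monom f d"
proof
  assume "homog f d"
  then show "grading f = monom f d"
    by (intro poly_eqI cpoly3_eqI) (auto simp: coeff3_grading homog_def)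
next
  assume *: "grading f = monom f d"
  show "homog f d" unfolding homog_def
    using coeff3_grading[of f "_ + _ + _"] by (metis * coeff3_0 coeff_monom)
qed

text \<open>The constant terms show that one factor is divisible by the variable; cancelling it
  lowers d.\<close>

lemma dvd_monom_imp_monom:
  fixes A B :: "'a::idom poly"
  assumes "A * B = monom g d" "g \<noteq> 0"
  shows "\<exists>a e. A = monom a e"
  using assms(1)
proof (induction d arbitrary: A B)
  case 0
  then have "degree (A * B) = 0" by (simp add: monom_0)
  moreover have "A \<noteq> 0" "B \<noteq> 0" using 0 assms(2) by auto
  ultimately have "degree A = 0" by (simp add: degree_mult_eq)
  then show ?case by (metis degree_eq_zeroE monom_0)
next
  case (Suc d)
  obtain a A' b B' where A: "A = pCons a A'" and B: "B = pCons b B'"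
    by (metis pCons_cases)
  have "coeff (A * B) 0 = 0" using Suc.prems by simp
  then consider "a = 0" | "b = 0" by (auto simp: A B coeff_mult)
  then show ?case
  proof cases
    case 1
    then have "A' * B = monom g d" using Suc.prems by (simp add: A monom_Suc)
    then obtain a' e where "A' = monom a' e" using Suc.IH by blast
    then have "A = monom a' (Suc e)" using 1 by (simp add: A monom_Suc)
    then show ?thesis by blast
  next
    case 2
    then have "A * B' = monom g d" using Suc.prems by (simp add: B monom_Suc)
    then show ?thesis using Suc.IH by blast
  qed
qed

text \<open>The grading is multiplicative, so the grading of a factor of g divides a monomial in t
  and is a monomial itself. All coefficients of p outside one degree then vanish.\<close>

lemma homog_dvd:
  assumes "homog g d" "g \<noteq> 0" "p dvd g"
  shows "\<exists>e. homog p e"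
proof -
  obtain h where h: "g = p * h" using assms(3) by blast
  have "grading p * grading h = monom g d"
    using assms(1) by (simp add: homog_iff_grading h grading_hom)
  then obtain a e where "grading p = monom a e"
    using dvd_monom_imp_monom assms(2) by blast
  then have "homog p e" unfolding homog_def
    using coeff3_grading[of p "_ + _ + _"] by (metis coeff3_0 coeff_monom)
  then show ?thesis by blast
qed

lemma homog_unique: "homog f a \<Longrightarrow> homog f b \<Longrightarrow> f \<noteq> 0 \<Longrightarrow> a = b"
  using cpoly3_eqI[of f 0] unfolding homog_def coeff3_0 by metis

lemma homog_quotient:
  assumes "homog (p * h) d" "homog p e" "p * h \<noteq> 0"
  shows "e \<le> d" "homog h (d - e)"
proof -
  obtain e' where e': "homog h e'" using homog_dvd[OF assms(1,3), of h] by auto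
  have "d = e + e'" using homog_unique[OF assms(1) homog_mult[OF assms(2) e'] assms(3)] .
  then show "e \<le> d" "homog h (d - e)" using e' by simp_all
qed

text \<open>For homogeneous p the grading of p * h is p times a power of t times the grading of h,
  so p divides each coefficient in t.\<close>

lemma dvd_homogeneous_components:
  assumes "homog p e" "p dvd g" shows "p dvd coeff (grading g) n"
proof -
  obtain h where h: "g = p * h" using assms(2) by blast
  have "grading g = smult p (monom 1 e * grading h)"
    using assms(1) by (simp add: h grading_hom homog_iff_grading smult_monom flip: mult_smult_left)
  then show ?thesis by simp
qed


subsection \<open>Prime divisors and gradients\<close>

lemma homog_dvd_lower_degree: "homog p e \<Longrightarrow> homog g d \<Longrightarrow> p dvd g \<Longrightarrow> d < e \<Longrightarrow> g = 0"
  using homog_quotient(1)[of p _ d e] by (metis dvdE leD)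

lemma homog_pos_degree:
  assumes "p \<noteq> 0" "\<not> is_unit p" "homog p e" shows "e > 0"
proof (rule ccontr)
  assume "\<not> e > 0"
  then have "p = const3 (coeff3 p 0 0 0)" using homog_0_imp_const3 assms(3) by simp
  then show False using is_unit_const3[of "coeff3 p 0 0 0"] assms by (metis const3_0)
qed

text \<open>The partial derivatives of p have smaller degree than p, so divisibility makes them
  zero; Euler's identity then gives e * p = 0 with e positive.\<close>

lemma prime_not_dvd_own_gradient:
  assumes p: "prime_elem p" and hp: "homog p e"
  shows "\<not> (p dvd dx p \<and> p dvd dy p \<and> p dvd dz p)"
proof
  assume *: "p dvd dx p \<and> p dvd dy p \<and> p dvd dz p"
  obtain d where e: "e = Suc d"
    using homog_pos_degree[OF _ _ hp] p gr0_conv_Suc by (auto simp: prime_elem_def)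
  have "dx p = 0" "dy p = 0" "dz p = 0"
    using homog_dvd_lower_degree[OF hp _ _ lessI[of d, folded e]] * hp
    by (auto simp: e intro: homog_dx homog_dy homog_dz)
  then have "of_nat e * p = 0" using euler_homog[OF hp] by simp
  then show False using p e by (simp add: prime_elem_def del: of_nat_Suc)
qed

text \<open>For g = p * h the product rule reduces the gradient of g modulo p to h times the
  gradient of p. Some component of the latter is prime to p, so p divides h.\<close>

lemma prime_square_dvd:
  assumes p: "prime_elem p" and hp: "homog p e" and "p dvd g"
    and grad: "p dvd dx g" "p dvd dy g" "p dvd dz g"
  shows "p ^ 2 dvd g"
proof -
  obtain h where h: "g = p * h" using assms(3) by blast
  have *: "p dvd h * d p" if "derivation d" "p dvd d g" for d
    using that(2) unfolding h derivation_mult[OF that(1)]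
    by (simp add: dvd_add_right_iff mult.commute)
  have "p dvd h"
    using *[OF derivation_dx grad(1)] *[OF derivation_dy grad(2)] *[OF derivation_dz grad(3)]
      prime_not_dvd_own_gradient[OF p hp] p by (auto simp: prime_elem_dvd_mult_iff)
  then show ?thesis by (auto simp: h power2_eq_square)
qed

subsection \<open>Prime divisors of the Jacobian of a pencil\<close>

lemma prime_not_dvd_const3: "prime_elem p \<Longrightarrow> p dvd const3 c \<Longrightarrow> c = 0"
  using is_unit_const3 dvd_trans by (metis prime_elem_def)

text \<open>Over the complex numbers a binary form in q1, q2 is a product of linear forms, that is,
  of members of the pencil. P is the dehomogenized form, and one linear factor is split off in each
  induction step.\<close>

lemma prime_not_dvd_binary_form:
  assumes p: "prime_elem p"
    and nd: "\<And>u v. (u, v) \<noteq> (0, 0) \<Longrightarrow> \<not> p dvd const3 u * q1 + const3 v * q2"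
    and "P \<noteq> 0" "degree P \<le> d"
  shows "\<not> p dvd (\<Sum>j\<le>d. const3 (coeff P j) * q1 ^ (d - j) * q2 ^ j)"
  using assms(3,4)
proof (induction d arbitrary: P)
  case 0
  then have "coeff P 0 \<noteq> 0" by (metis leading_coeff_0_iff le_zero_eq)
  then show ?case using prime_not_dvd_const3[OF p] by auto
next
  case (Suc d)
  show ?case
  proof (cases "degree P \<le> d")
    case True
    \<comment> \<open>A degree drop of P is a root at infinity, which accounts for the linear factor
      q1.\<close>
    have "(\<Sum>j\<le>Suc d. const3 (coeff P j) * q1 ^ (Suc d - j) * q2 ^ j)
        = q1 * (\<Sum>j\<le>d. const3 (coeff P j) * q1 ^ (d - j) * q2 ^ j)"
      using True by (simp add: coeff_eq_0 sum_distrib_left Suc_diff_le mult_ac)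
    moreover have "\<not> p dvd q1" using nd[of 1 0] by simp
    ultimately show ?thesis using Suc.IH[OF Suc.prems(1) True] p
      by (simp add: prime_elem_dvd_mult_iff)
  next
    case False
    then have deg: "degree P = Suc d" using Suc.prems by simp
    then have "\<not> constant (poly P)" by (simp add: constant_degree)
    then obtain a where "poly P a = 0" using fundamental_theorem_of_algebra by blast
    then obtain Q where Q: "P = [:- a, 1:] * Q" by (auto simp: poly_eq_0_iff_dvd)
    then have Q0: "Q \<noteq> 0" using Suc.prems by auto
    have "degree P = Suc (degree Q)" unfolding Q using Q0 by (subst degree_mult_eq) auto
    then have dQ: "degree Q = d" using deg by simp
    let ?S = "\<Sum>j\<le>d. const3 (coeff Q j) * q1 ^ (d - j) * q2 ^ j"
    \<comment> \<open>Multiplying Q by the linear factor with root a mixes each coefficient with the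
      preceding one; on the form this is multiplication by q2 - a q1.\<close>
    have cP: "coeff P j = - a * coeff Q j + (case j of 0 \<Rightarrow> 0 | Suc j \<Rightarrow> coeff Q j)" for j
      by (simp add: Q coeff_pCons split: nat.splits)
    have "(\<Sum>j\<le>Suc d. const3 (coeff P j) * q1 ^ (Suc d - j) * q2 ^ j)
        = (\<Sum>j\<le>Suc d. const3 (- a) * const3 (coeff Q j) * q1 ^ (Suc d - j) * q2 ^ j)
        + (\<Sum>j\<le>Suc d. const3 (case j of 0 \<Rightarrow> 0 | Suc j \<Rightarrow> coeff Q j) * q1 ^ (Suc d - j) * q2 ^ j)"
      unfolding cP const3_add const3_mult by (simp add: sum.distrib algebra_simps)
    also have "(\<Sum>j\<le>Suc d. const3 (- a) * const3 (coeff Q j) * q1 ^ (Suc d - j) * q2 ^ j)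
        = const3 (- a) * q1 * ?S"
      using dQ by (simp add: coeff_eq_0 sum_distrib_left Suc_diff_le mult_ac)
    also have "(\<Sum>j\<le>Suc d. const3 (case j of 0 \<Rightarrow> 0 | Suc j \<Rightarrow> coeff Q j) * q1 ^ (Suc d - j) * q2 ^ j)
        = q2 * ?S"
      by (subst sum.atMost_Suc_shift) (simp add: sum_distrib_left mult_ac)
    finally have "(\<Sum>j\<le>Suc d. const3 (coeff P j) * q1 ^ (Suc d - j) * q2 ^ j)
        = (const3 (- a) * q1 + const3 1 * q2) * ?S" by (simp add: algebra_simps)
    moreover have "\<not> p dvd const3 (- a) * q1 + const3 1 * q2" by (rule nd) simp
    ultimately show ?thesis using Suc.IH[OF Q0] dQ p
      by (simp add: prime_elem_dvd_mult_iff)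
  qed
qed

text \<open>Since p is homogeneous, it would divide each homogeneous component of the sum. The
  component that contains the given nonzero coefficient is a nonzero binary form in q1, q2.\<close>

lemma prime_not_dvd_binary_poly:
  assumes p: "prime_elem p" and hp: "homog p e"
    and nd: "\<And>u v. (u, v) \<noteq> (0, 0) \<Longrightarrow> \<not> p dvd const3 u * q1 + const3 v * q2"
    and hq: "homog q1 k" "homog q2 k" and k: "k > 0"
    and nz: "i0 < M" "j0 < M" "c i0 j0 \<noteq> 0"
  shows "\<not> p dvd (\<Sum>i<M. \<Sum>j<M. const3 (c i j) * q1 ^ i * q2 ^ j)"
proof
  assume *: "p dvd (\<Sum>i<M. \<Sum>j<M. const3 (c i j) * q1 ^ i * q2 ^ j)" (is "p dvd ?S")
  define d where "d = i0 + j0"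
  \<comment> \<open>P holds the coefficients on the antidiagonal i + j = d, with 0 outside the
    square of indices below M.\<close>
  define P where "P = (\<Sum>j\<le>d. monom (if j < M \<and> d - j < M then c (d - j) j else 0) j)"
  have cP: "coeff P j = (if j \<le> d \<and> j < M \<and> d - j < M then c (d - j) j else 0)" for j
    by (auto simp: P_def coeff_sum)
  have "coeff P j0 \<noteq> 0" using nz by (simp add: cP d_def)
  then have P0: "P \<noteq> 0" by auto
  have degP: "degree P \<le> d" by (rule degree_le) (simp add: cP)
  have "grading (const3 a * q1 ^ i * q2 ^ j) = monom (const3 a * q1 ^ i * q2 ^ j) (k * (i + j))" for a i j
    using homog_mult[OF homog_mult[OF homog_const3 homog_power[OF hq(1)]] homog_power[OF hq(2)], of a i j]
    by (simp add: homog_iff_grading algebra_simps)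
  \<comment> \<open>As k is positive, the terms of degree k * d are exactly those with i + j =
    d.\<close>
  then have "coeff (grading ?S) (k * d)
      = (\<Sum>i<M. \<Sum>j<M. if i + j = d then const3 (c i j) * q1 ^ i * q2 ^ j else 0)"
    using k by (simp add: grading_sum coeff_sum)
  also have "\<dots> = (\<Sum>(i, j)\<in>{..<M} \<times> {..<M}. if i + j = d then const3 (c i j) * q1 ^ i * q2 ^ j else 0)"
    by (simp add: sum.cartesian_product)
  also have "\<dots> = (\<Sum>(i, j)\<in>{(i, j). i < M \<and> j < M \<and> i + j = d}. const3 (c i j) * q1 ^ i * q2 ^ j)"
    by (rule sum.mono_neutral_cong_right) (auto split: if_splits)
  also have "\<dots> = (\<Sum>j\<in>{j. j \<le> d \<and> j < M \<and> d - j < M}. const3 (coeff P j) * q1 ^ (d - j) * q2 ^ j)"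
    by (rule sum.reindex_bij_witness[of _ "\<lambda>j. (d - j, j)" snd]) (auto simp: cP)
  also have "\<dots> = (\<Sum>j\<le>d. const3 (coeff P j) * q1 ^ (d - j) * q2 ^ j)"
    by (rule sum.mono_neutral_left) (auto simp: cP)
  finally show False
    using dvd_homogeneous_components[OF hp *, of "k * d"] prime_not_dvd_binary_form[OF p nd P0 degP]
    by simp
qed

text \<open>Differentiating an algebraic relation of w over constants of D modulo p lowers its degree.\<close>
lemma prime_not_dvd_poly_over_constants:
  fixes p w :: "'a::{idom,ring_char_0}"
  assumes p: "prime_elem p" and D: "derivation D" "p dvd D p" "\<not> p dvd D w"
    and K: "\<And>G. G \<in> K \<Longrightarrow> G \<noteq> 0 \<Longrightarrow> \<not> p dvd G" "\<And>G. G \<in> K \<Longrightarrow> p dvd D G"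
      "\<And>n G. G \<in> K \<Longrightarrow> of_nat n * G \<in> K"
    and F: "F \<noteq> 0" "\<And>n. coeff F n \<in> K"
  shows "\<not> p dvd poly F w"
  using F
proof (induction "degree F" arbitrary: F rule: less_induct)
  case less
  show ?case
  proof (cases "degree F = 0")
    case True
    then obtain a where "F = [:a:]" by (rule degree_eq_zeroE)
    then show ?thesis using less.prems(1) less.prems(2)[of 0] K(1) by simp
  next
    case False
    show ?thesis
    proof
      assume "p dvd poly F w"
      then have "p dvd D (poly F w)"
        using D(2) by (auto simp: derivation_mult[OF D(1)])
      then have "p dvd poly (pderiv F) w * D w"
        using poly_derivation_cong[OF D(1) K(2)[OF less.prems(2)], of w] by (simp add: dvd_diff_right_iff)
      then have "p dvd poly (pderiv F) w" using D(3) p by (simp add: prime_elem_dvd_mult_iff)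
      \<comment> \<open>Characteristic zero keeps the derivative of a nonconstant F nonzero, and
        closure of K under natural multiples keeps its coefficients in K, so the smaller degree
        contradicts the induction hypothesis.\<close>
      moreover have "pderiv F \<noteq> 0" using False by (simp add: pderiv_eq_0_iff)
      moreover have "degree (pderiv F) < degree F" using False by (simp add: degree_pderiv)
      moreover have "coeff (pderiv F) n \<in> K" for n
        using K(3) less.prems(2) by (simp add: coeff_pderiv del: of_nat_Suc)
      ultimately show False using less.hyps by blast
    qed
  qed
qed

section \<open>Linear dependence over the complex numbers and algebraic relations modulo p\<close>

interpretation cpoly3: vector_space "\<lambda>c (f :: cpoly3). const3 c * f"
  by unfold_locales (simp_all add: const3_add const3_mult algebra_simps)

text \<open>For an injective family this is the bound on independent sets in the span of T. A
  repeated vector gives the relation with coefficients 1 and -1.\<close>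

lemma vector_space_dependent_family:
  fixes v :: "'i \<Rightarrow> cpoly3"
  assumes "finite I" "finite T" "card T < card I" "\<And>i. i \<in> I \<Longrightarrow> v i \<in> cpoly3.span T"
  shows "\<exists>c. (\<exists>i\<in>I. c i \<noteq> 0) \<and> (\<Sum>i\<in>I. const3 (c i) * v i) = 0"
proof (cases "inj_on v I")
  case True
  have "cpoly3.dependent (v ` I)"
    using cpoly3.independent_span_bound[of T "v ` I"] assms card_image[OF True] by fastforce
  then obtain u where "\<exists>x\<in>v ` I. u x \<noteq> 0" "(\<Sum>x\<in>v ` I. const3 (u x) * x) = 0"
    using cpoly3.dependent_finite[of "v ` I"] assms(1) by auto
  then show ?thesis
    by (intro exI[of _ "u \<circ> v"]) (auto simp: sum.reindex[OF True])
next
  case False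
  then obtain i j where ij: "i \<in> I" "j \<in> I" "i \<noteq> j" "v i = v j" by (auto simp: inj_on_def)
  define c where "c x = (if x = i then 1 else if x = j then -1 else 0 :: complex)" for x
  have "(\<Sum>x\<in>I. const3 (c x) * v x) = (\<Sum>x\<in>{i, j}. const3 (c x) * v x)"
    using ij assms(1) by (intro sum.mono_neutral_right) (auto simp: c_def)
  also have "\<dots> = 0" using ij by (simp add: c_def const3_minus)
  finally show ?thesis using ij by (intro exI[of _ c]) (auto simp: c_def intro: bexI[of _ i])
qed

lemma const3_mult_term3: "const3 c * term3 a i j l = term3 (c * a) i j l"
  by (simp only: term3_eq const3_mult mult.assoc)

lemma in_span_terms:
  assumes "\<And>i j l. coeff3 f i j l \<noteq> 0 \<Longrightarrow> i < N \<and> j < N \<and> l < N"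
  shows "f \<in> cpoly3.span ((\<lambda>(i, j, l). term3 1 i j l) ` ({..<N} \<times> {..<N} \<times> {..<N}))"
proof -
  have "f = (\<Sum>(i, j, l) \<in> {..<N} \<times> {..<N} \<times> {..<N}. const3 (coeff3 f i j l) * term3 1 i j l)"
    by (subst term3_expansion[OF assms]) (simp_all add: const3_mult_term3)
  also have "\<dots> \<in> cpoly3.span ((\<lambda>(i, j, l). term3 1 i j l) ` ({..<N} \<times> {..<N} \<times> {..<N}))"
    by (intro cpoly3.span_sum) (force intro: cpoly3.span_scale cpoly3.span_base)
  finally show ?thesis .
qed

lemma coeff3_mult_term3_bound:
  assumes "homog p e" "coeff3 (p * term3 1 i' j' l') i j l \<noteq> 0"
  shows "i \<le> e + i' \<and> j \<le> e + j' \<and> l \<le> e + l'"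
proof -
  obtain l1 j1 i1 where *: "l1 \<le> l" "j1 \<le> j" "i1 \<le> i"
    and "coeff3 p i1 j1 l1 * coeff3 (term3 1 i' j' l') (i - i1) (j - j1) (l - l1) \<noteq> 0"
    using assms(2) unfolding coeff3_mult
    by (metis (no_types, lifting) atMost_iff sum.not_neutral_contains_not_neutral)
  then have "coeff3 p i1 j1 l1 \<noteq> 0" "i - i1 = i'" "j - j1 = j'" "l - l1 = l'"
    by (auto simp: coeff3_term3 split: if_splits)
  moreover from this have "i1 + j1 + l1 = e" using assms(1) by (auto simp: homog_def)
  ultimately show ?thesis using * by linarith
qed

text \<open>The M^3 products and n^3 multiples of p are more than the N^3 monomials with all exponents
  below N, in whose span they lie.\<close>
lemma algebraic_relation_mod:
  assumes p: "p \<noteq> 0" and hp: "homog p e" and e: "e > 0"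
    and hom: "homog q1 k" "homog q2 k" "homog w 1" and k: "k > 0"
  shows "\<exists>M c. (\<exists>i<M. \<exists>j<M. \<exists>l<M. c i j l \<noteq> 0) \<and>
    p dvd (\<Sum>(i, j, l) \<in> {..<M} \<times> {..<M} \<times> {..<M}. const3 (c i j l) * (q1 ^ i * q2 ^ j * w ^ l))"
proof -
  \<comment> \<open>L is chosen so that L^3 exceeds (3kL + 1)^3 - (3kL)^3 = 27 k^2 L^2 + 9kL + 1.
    Scaling by e^3 turns this into N^3 < M^3 + n^3.\<close>
  define L where "L = 27 * k ^ 2 + 9 * k + 2"
  define M where "M = e * L"
  \<comment> \<open>The products have degree below 3kM, and multiplying a monomial by p raises each
    exponent by at most e; hence N = n + e bounds the exponents on both sides.\<close>
  define n where "n = 3 * k * M"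
  define N where "N = n + e"
  define B where "B = (\<lambda>m::nat. {..<m} \<times> {..<m} \<times> {..<m})"
  have cardB: "card (B m) = m ^ 3" and finB: "finite (B m)" for m
    by (simp_all add: B_def card_cartesian_product power3_eq_cube mult.assoc)
  define T where "T = (\<lambda>(i, j, l). term3 1 i j l) ` B N"
  define v where "v = case_sum (\<lambda>(i, j, l). q1 ^ i * q2 ^ j * w ^ l) (\<lambda>(i, j, l). p * term3 1 i j l)"
  have M0: "M > 0" using e by (simp add: M_def L_def)
  have "L ^ 3 = (27 * k ^ 2 + 9 * k + 2) * L ^ 2"
    by (simp add: L_def power3_eq_cube power2_eq_square)
  then have L: "L ^ 3 = 27 * k ^ 2 * L ^ 2 + 9 * k * L ^ 2 + 2 * L ^ 2" by (simp add: algebra_simps)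
  have "L \<le> L ^ 2" "0 < L ^ 2" by (simp_all add: power2_eq_square L_def)
  then have "9 * k * L \<le> 9 * k * L ^ 2" "1 < 2 * L ^ 2" by simp_all
  then have "27 * k ^ 2 * L ^ 2 + 9 * k * L + 1 < L ^ 3" using L by linarith
  then have "(3 * k * L + 1) ^ 3 < L ^ 3 + (3 * k * L) ^ 3"
    by (simp add: power3_eq_cube power2_eq_square algebra_simps)
  then have "e ^ 3 * (3 * k * L + 1) ^ 3 < e ^ 3 * (L ^ 3 + (3 * k * L) ^ 3)" using e by simp
  then have "N ^ 3 < M ^ 3 + n ^ 3"
    by (simp add: N_def n_def M_def power3_eq_cube algebra_simps)
  moreover have "card T \<le> N ^ 3" unfolding T_def using card_image_le[OF finB] cardB by metis
  ultimately have card: "card T < card (B M <+> B n)" by (simp add: card_Plus finB cardB)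
  have "v x \<in> cpoly3.span T" if x: "x \<in> B M <+> B n" for x
    using x unfolding T_def B_def
  proof (elim PlusE; intro in_span_terms)
    fix y i j l assume y: "y \<in> {..<M} \<times> {..<M} \<times> {..<M}" "x = Inl y" and nz: "coeff3 (v x) i j l \<noteq> 0"
    obtain i' j' l' where y': "y = (i', j', l')" by (cases y)
    have "homog (v x) (i' * k + j' * k + l' * 1)"
      unfolding y y' v_def sum.case prod.case by (intro homog_mult homog_power hom)
    then have "i + j + l = i' * k + j' * k + l'" using nz by (simp add: homog_def)
    moreover have "i' * k < M * k" "j' * k < M * k" using y y' k by auto
    moreover have "l' < M * k" using y y' k by (cases k) auto
    moreover have "N = 3 * (M * k) + e" by (simp add: N_def n_def)
    ultimately have "i + j + l < N" by linarith
    then show "i < N \<and> j < N \<and> l < N" by linarith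
  next
    fix y i j l assume y: "y \<in> {..<n} \<times> {..<n} \<times> {..<n}" "x = Inr y" and nz: "coeff3 (v x) i j l \<noteq> 0"
    then show "i < N \<and> j < N \<and> l < N"
      using coeff3_mult_term3_bound[OF hp] by (fastforce simp: v_def N_def)
  qed
  then obtain c where c: "\<exists>x\<in>B M <+> B n. c x \<noteq> 0" "(\<Sum>x\<in>B M <+> B n. const3 (c x) * v x) = 0"
    using vector_space_dependent_family[OF _ _ card, of v] finB by (auto simp: T_def)
  define c1 where "c1 i j l = c (Inl (i, j, l))" for i j l
  define h where "h = (\<Sum>(i, j, l)\<in>B n. term3 (c (Inr (i, j, l))) i j l)"
  define S where "S = (\<Sum>(i, j, l)\<in>B M. const3 (c1 i j l) * (q1 ^ i * q2 ^ j * w ^ l))"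
  have "S + p * h = 0"
    using c(2) unfolding sum.Plus[OF finB finB]
    by (simp add: S_def h_def v_def c1_def sum_distrib_left case_prod_unfold comp_def
        mult.left_commute[of _ p] const3_mult_term3)
  then have S: "S = p * (- h)" by (simp add: eq_neg_iff_add_eq_0)
  \<comment> \<open>The dependence must involve the products: otherwise p * h = 0, so h = 0, and the
    independent monomials in h have zero coefficients too.\<close>
  have "\<exists>i<M. \<exists>j<M. \<exists>l<M. c1 i j l \<noteq> 0"
  proof (rule ccontr)
    assume neg: "\<not> ?thesis"
    then have "S = 0" unfolding S_def by (intro sum.neutral) (auto simp: B_def)
    then have h0: "h = 0" using S p by simp
    obtain i j l where ijl: "i < n" "j < n" "l < n" "c (Inr (i, j, l)) \<noteq> 0"
      using c(1) neg unfolding B_def c1_def by (elim bexE PlusE) auto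
    have "coeff3 h i j l = (\<Sum>x\<in>B n. if x = (i, j, l) then c (Inr (i, j, l)) else 0)"
      unfolding h_def coeff3_sum by (intro sum.cong) (auto simp: coeff3_term3 split: if_splits)
    also have "\<dots> = c (Inr (i, j, l))" using ijl finB by (auto simp: B_def)
    finally show False using ijl h0 by simp
  qed
  moreover have "p dvd S" unfolding S by simp
  ultimately show ?thesis unfolding S_def B_def by blast
qed


section \<open>Jacobian minors and members of the pencil\<close>

lemma prime_dvd_of_nat_mult:
  fixes p :: cpoly3
  assumes "prime_elem p" "p dvd of_nat n * h" "n > 0" shows "p dvd h"
proof -
  have "\<not> p dvd of_nat n"
    using prime_not_dvd_const3[OF assms(1), of "of_nat n"] assms(3) by (auto simp: const3_of_nat)
  then show ?thesis using assms by (simp add: prime_elem_dvd_mult_iff)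
qed

text \<open>The three polynomials are the components of the cross product of the gradients of g and
  h.\<close>

definition jac1 :: "cpoly3 \<Rightarrow> cpoly3 \<Rightarrow> cpoly3" where "jac1 g h = dy g * dz h - dz g * dy h"
definition jac2 :: "cpoly3 \<Rightarrow> cpoly3 \<Rightarrow> cpoly3" where "jac2 g h = dz g * dx h - dx g * dz h"
definition jac3 :: "cpoly3 \<Rightarrow> cpoly3 \<Rightarrow> cpoly3" where "jac3 g h = dx g * dy h - dy g * dx h"

text \<open>Contracting dg \<and> dh with the Euler field gives b h dg - a g dh.\<close>
lemma prime_dvd_gradient:
  assumes p: "prime_elem p" "p dvd g" "\<not> p dvd h" and hom: "homog g a" "homog h b" "b > 0"
    and jac: "p dvd jac1 g h" "p dvd jac2 g h" "p dvd jac3 g h"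
  shows "p dvd dx g \<and> p dvd dy g \<and> p dvd dz g"
proof -
  note eg = euler_homog[OF hom(1)] and eh = euler_homog[OF hom(2)]
  have *: "p dvd d" if "p dvd d * (of_nat b * h) - d' * (of_nat a * g)" for d d'
  proof -
    have "p dvd d * (of_nat b * h)" using that p(2) by (simp add: dvd_diff_left_iff)
    then have "p dvd of_nat b * (h * d)" by (simp add: mult_ac)
    then have "p dvd h * d" by (rule prime_dvd_of_nat_mult[OF p(1) _ hom(3)])
    then show ?thesis using p by (simp add: prime_elem_dvd_mult_iff)
  qed
  have "dx g * (of_nat b * h) - dx h * (of_nat a * g) = vy * jac3 g h - vz * jac2 g h"
    unfolding eg[symmetric] eh[symmetric] jac1_def jac2_def jac3_def by (simp add: algebra_simps)
  moreover have "dy g * (of_nat b * h) - dy h * (of_nat a * g) = vz * jac1 g h - vx * jac3 g h"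
    unfolding eg[symmetric] eh[symmetric] jac1_def jac2_def jac3_def by (simp add: algebra_simps)
  moreover have "dz g * (of_nat b * h) - dz h * (of_nat a * g) = vx * jac2 g h - vy * jac1 g h"
    unfolding eg[symmetric] eh[symmetric] jac1_def jac2_def jac3_def by (simp add: algebra_simps)
  ultimately show ?thesis using jac by (metis * dvd_diff dvd_mult)
qed

lemma derivs_const3_mult: "dx (const3 c * f) = const3 c * dx f" "dy (const3 c * f) = const3 c * dy f"
  "dz (const3 c * f) = const3 c * dz f"
  by (auto intro!: cpoly3_eqI simp: coeff3_dx coeff3_dy coeff3_dz coeff3_const3_mult)

lemma derivs_const3: "dx (const3 c) = 0" "dy (const3 c) = 0" "dz (const3 c) = 0"
  using derivs_const3_mult[of c 1] derivation_1[OF derivation_dx] derivation_1[OF derivation_dy]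
    derivation_1[OF derivation_dz] by simp_all

lemma derivs_vars: "dx vx = 1" "dy vx = 0" "dz vx = 0" "dx vy = 0" "dy vy = 1" "dz vy = 0"
  "dx vz = 0" "dy vz = 0" "dz vz = 1"
  by (simp_all add: dx_def dy_def dz_def vx_def vy_def vz_def map_poly_pCons pderiv_pCons one_pCons)

lemma dvd_derivation_power: "derivation D \<Longrightarrow> p dvd D a \<Longrightarrow> p dvd D (a ^ n)"
  by (induction n) (simp_all add: derivation_1 derivation_mult)

text \<open>If p divided no member, the polynomials in q1, q2 would be nonzero modulo p as soon as
  one coefficient is nonzero. They are constants modulo p of a derivation that moves some variable
  w, yet w satisfies an algebraic relation over them modulo p.\<close>

lemma prime_dvd_jacobian_imp_dvd_member:
  assumes p: "prime_elem p" and hp: "homog p e" and hq: "homog q1 k" "homog q2 k" and k: "k > 0"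
    and jac: "p dvd jac1 q1 q2" "p dvd jac2 q1 q2" "p dvd jac3 q1 q2"
  shows "\<exists>u v. (u, v) \<noteq> (0, 0) \<and> p dvd const3 u * q1 + const3 v * q2"
proof (rule ccontr)
  assume "\<not> ?thesis"
  then have nd: "\<not> p dvd const3 u * q1 + const3 v * q2" if "(u, v) \<noteq> (0, 0)" for u v
    using that by blast
  have p0: "p \<noteq> 0" using p by auto
  have e: "e > 0" using homog_pos_degree[OF p0 _ hp] p by (auto simp: prime_elem_def)
  \<comment> \<open>D h is the determinant of the gradients of p, q1 and h. It vanishes on p and q1,
    and a cyclic permutation expands D q2 in the minors of q1, q2.\<close>
  define D where "D h = jac1 p q1 * dx h + jac2 p q1 * dy h + jac3 p q1 * dz h" for h
  have D: "derivation D" unfolding D_def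
    by (rule derivation_lin_comb[OF derivation_dx derivation_dy derivation_dz])
  have Dp: "p dvd D p" and Dq1: "p dvd D q1"
    by (simp_all add: D_def jac1_def jac2_def jac3_def algebra_simps)
  have "D q2 = dx p * jac1 q1 q2 + dy p * jac2 q1 q2 + dz p * jac3 q1 q2"
    by (simp add: D_def jac1_def jac2_def jac3_def algebra_simps)
  then have Dq2: "p dvd D q2" using jac by simp
  have "\<not> p dvd q1" using nd[of 1 0] by simp
  \<comment> \<open>Otherwise \<open>prime_dvd_gradient\<close>, applied to p and q1, would make p
    divide its own gradient.\<close>
  then have "\<not> (p dvd jac1 p q1 \<and> p dvd jac2 p q1 \<and> p dvd jac3 p q1)"
    using prime_dvd_gradient[OF p dvd_refl _ hp hq(1) k] prime_not_dvd_own_gradient[OF p hp] by blast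
  moreover have "D vx = jac1 p q1" "D vy = jac2 p q1" "D vz = jac3 p q1"
    by (simp_all add: D_def derivs_vars)
  ultimately obtain w where w: "homog w 1" "\<not> p dvd D w"
    using homog_vx homog_vy homog_vz by metis
  obtain M c i0 j0 l0 where nz: "i0 < M" "j0 < M" "l0 < M" "c i0 j0 l0 \<noteq> 0"
    and rel: "p dvd (\<Sum>(i, j, l) \<in> {..<M} \<times> {..<M} \<times> {..<M}. const3 (c i j l) * (q1 ^ i * q2 ^ j * w ^ l))"
    using algebraic_relation_mod[OF p0 hp e hq w(1) k] by blast
  define G where "G M c = (\<Sum>i<M. \<Sum>j<M. const3 (c i j) * q1 ^ i * q2 ^ j)" for M :: nat and c
  define K where "K = {G M c | M c. True}"
  have G_nd: "\<not> p dvd G M c" if "i < M" "j < M" "c i j \<noteq> 0" for M c i j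
    unfolding G_def by (rule prime_not_dvd_binary_poly[where c = c, OF p hp nd hq k that])
  have K1: "\<not> p dvd g" if gK: "g \<in> K" and g0: "g \<noteq> 0" for g
  proof -
    obtain M c where g: "g = G M c" using gK by (auto simp: K_def)
    have "\<exists>i<M. \<exists>j<M. c i j \<noteq> 0"
    proof (rule ccontr)
      assume "\<not> ?thesis"
      then have "G M c = 0" unfolding G_def by (intro sum.neutral ballI) auto
      then show False using g g0 by simp
    qed
    then show ?thesis using G_nd g by blast
  qed
  have Dc: "D (const3 a) = 0" for a by (simp add: D_def derivs_const3)
  have K2: "p dvd D g" if gK: "g \<in> K" for g
  proof -
    obtain M c where g: "g = G M c" using gK by (auto simp: K_def)
    show ?thesis unfolding g G_def derivation_sum[OF D] derivation_mult[OF D] Dc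
      using dvd_derivation_power[OF D Dq1] dvd_derivation_power[OF D Dq2]
      by (intro dvd_sum) simp
  qed
  have K3: "of_nat n * g \<in> K" if gK: "g \<in> K" for n g
  proof -
    obtain M c where g: "g = G M c" using gK by (auto simp: K_def)
    have "of_nat n * g = G M (\<lambda>i j. of_nat n * c i j)"
      by (simp add: g G_def const3_mult const3_of_nat sum_distrib_left mult_ac)
    then show ?thesis by (auto simp: K_def)
  qed
  \<comment> \<open>The relation is sorted by powers of w, so that its coefficients are elements of
    K.\<close>
  define F where "F = (\<Sum>l<M. monom (G M (\<lambda>i j. c i j l)) l)"
  have cF: "coeff F l = (if l < M then G M (\<lambda>i j. c i j l) else 0)" for l
    by (auto simp: F_def coeff_sum)
  \<comment> \<open>The empty sum puts 0 into K, as needed for the coefficients of F from index M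
    on.\<close>
  have "G 0 undefined = 0" by (simp add: G_def)
  then have "0 \<in> K" by (force simp: K_def)
  then have KF: "coeff F n \<in> K" for n by (auto simp: cF K_def)
  have "coeff F l0 \<noteq> 0" using G_nd[of i0 M j0 "\<lambda>i j. c i j l0"] nz by (auto simp: cF)
  then have F0: "F \<noteq> 0" by auto
  have "(\<Sum>(i, j, l) \<in> {..<M} \<times> {..<M} \<times> {..<M}. const3 (c i j l) * (q1 ^ i * q2 ^ j * w ^ l))
      = (\<Sum>i<M. \<Sum>j<M. \<Sum>l<M. const3 (c i j l) * q1 ^ i * q2 ^ j * w ^ l)"
    by (simp add: sum.cartesian_product mult_ac)
  also have "\<dots> = (\<Sum>i<M. \<Sum>l<M. \<Sum>j<M. const3 (c i j l) * q1 ^ i * q2 ^ j * w ^ l)"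
    by (intro sum.cong refl sum.swap)
  also have "\<dots> = (\<Sum>l<M. \<Sum>i<M. \<Sum>j<M. const3 (c i j l) * q1 ^ i * q2 ^ j * w ^ l)"
    by (rule sum.swap)
  also have "\<dots> = poly F w"
    by (simp add: F_def G_def poly_sum poly_monom sum_distrib_right)
  finally show False
    using rel prime_not_dvd_poly_over_constants[OF p D Dp w(2) K1 K2 K3 F0 KF] by simp
qed

text \<open>Such a p divides a member g and, by contraction with the Euler field, also its gradient.
  Then the square of p divides g, which is squarefree.\<close>

lemma prime_not_dvd_jacobian:
  assumes p: "prime_elem p" and hp: "homog p e" and hq: "homog q1 k" "homog q2 k" and k: "k > 0"
    and coprime: "\<not> (p dvd q1 \<and> p dvd q2)"
    and sqf: "\<And>u v. (u, v) \<noteq> (0, 0) \<Longrightarrow> squarefree (const3 u * q1 + const3 v * q2)"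
  shows "\<not> (p dvd jac1 q1 q2 \<and> p dvd jac2 q1 q2 \<and> p dvd jac3 q1 q2)"
proof
  assume jac: "p dvd jac1 q1 q2 \<and> p dvd jac2 q1 q2 \<and> p dvd jac3 q1 q2"
  then obtain u v where uv: "(u, v) \<noteq> (0, 0)" and pg: "p dvd const3 u * q1 + const3 v * q2"
    using prime_dvd_jacobian_imp_dvd_member[OF p hp hq k] by blast
  define g where "g = const3 u * q1 + const3 v * q2"
  \<comment> \<open>A generator that spans the pencil together with g; coprimality of q1, q2 at p
    keeps p from dividing it.\<close>
  define h where "h = (if v = 0 then q2 else q1)"
  have hg: "homog g k" unfolding g_def by (intro homog_add homog_mult_const3 hq)
  have hh: "homog h k" using hq by (simp add: h_def)
  have c: "p dvd x" if "p dvd const3 a * x" "a \<noteq> 0" for a x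
    using that prime_not_dvd_const3[OF p] p by (auto simp: prime_elem_dvd_mult_iff)
  have ph: "\<not> p dvd h"
  proof
    assume h: "p dvd h"
    show False
    proof (cases "v = 0")
      case True
      then have "p dvd q1" using pg uv c[of u q1] by simp
      then show False using h True coprime by (simp add: h_def)
    next
      case False
      then have "p dvd q1" using h by (simp add: h_def)
      then have "p dvd const3 v * q2" using pg by (simp add: dvd_add_right_iff)
      then show False using c[of v q2] False \<open>p dvd q1\<close> coprime by simp
    qed
  qed
  have dg: "dx g = const3 u * dx q1 + const3 v * dx q2" "dy g = const3 u * dy q1 + const3 v * dy q2"
    "dz g = const3 u * dz q1 + const3 v * dz q2"
    by (simp_all add: g_def derivation_add derivation_dx derivation_dy derivation_dz derivs_const3_mult)
  \<comment> \<open>The determinant of the base change from q1, q2 to g, h.\<close>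
  define s where "s = (if v = 0 then const3 u else - const3 v)"
  have "jac1 g h = s * jac1 q1 q2" "jac2 g h = s * jac2 q1 q2" "jac3 g h = s * jac3 q1 q2"
    by (simp_all add: jac1_def jac2_def jac3_def dg s_def h_def algebra_simps)
  then have "p dvd dx g \<and> p dvd dy g \<and> p dvd dz g"
    using prime_dvd_gradient[OF p _ ph hg hh k] pg jac by (simp add: g_def)
  then have "p ^ 2 dvd g" using prime_square_dvd[OF p hp] pg by (simp add: g_def)
  then show False using squarefreeD[OF sqf[OF uv]] p by (auto simp: g_def prime_elem_def)
qed

subsection \<open>Syzygies\<close>

text \<open>Homogeneous primes suffice as tests, because every divisor of a nonzero homogeneous
  polynomial is homogeneous.\<close>

lemma gcd3_unit:
  fixes a b c :: cpoly3
  assumes hom: "homog a d" "homog b d" "homog c d"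
    and nd: "\<And>p e. prime_elem p \<Longrightarrow> homog p e \<Longrightarrow> \<not> (p dvd a \<and> p dvd b \<and> p dvd c)"
  shows "is_unit (gcd a (gcd b c))"
proof (rule ccontr)
  assume nu: "\<not> is_unit (gcd a (gcd b c))"
  \<comment> \<open>A zero gcd means a = b = c = 0; the nonunit \<open>vz\<close> then serves as the
    common divisor.\<close>
  define g where "g = (if gcd a (gcd b c) = 0 then vz else gcd a (gcd b c))"
  have dvd: "g dvd a" "g dvd b" "g dvd c"
    by (simp_all add: g_def) (metis gcd_dvd1 gcd_dvd2 dvd_trans)+
  have "\<not> is_unit vz"
  proof
    assume "is_unit vz"
    then obtain h where "vz * h = 1" by (metis dvdE)
    then show False using homog_quotient(1)[of vz h 0 1] homog_vz homog_1 by simp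
  qed
  then have vz: "vz \<noteq> 0" "\<not> is_unit vz" by (auto simp: vz_def)
  then have "g \<noteq> 0" "\<not> is_unit g" using nu by (auto simp: g_def)
  then obtain p where p: "p dvd g" "prime p" using prime_divisor_exists by blast
  have "\<exists>x d. g dvd x \<and> x \<noteq> 0 \<and> homog x d"
  proof (cases "gcd a (gcd b c) = 0")
    case True
    then show ?thesis using vz(1) homog_vz by (intro exI[of _ vz] exI[of _ 1]) (simp add: g_def)
  next
    case False
    then show ?thesis using dvd hom by auto
  qed
  then obtain e where "homog p e" using homog_dvd p(1) dvd_trans by metis
  then show False using nd[of p e] p dvd dvd_trans by (metis prime_imp_prime_elem)
qed

lemma dvd_mult_gcd:
  fixes a :: "'a::{semiring_gcd,factorial_semiring_gcd,semiring_gcd_mult_normalize}"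
  assumes "a dvd v * b" "a dvd v * c" shows "a dvd v * gcd b c"
proof -
  have "a dvd gcd (v * b) (v * c)" using assms by simp
  then show ?thesis by (simp add: gcd_mult_left)
qed

text \<open>The relations make a divide v1 * a, v1 * b and v1 * c, hence v1 times the gcd, which is
  a unit.\<close>

lemma parallel_to_primitive_aux:
  fixes a b c :: cpoly3
  assumes "is_unit (gcd a (gcd b c))" "a \<noteq> 0" "a * v2 = b * v1" "a * v3 = c * v1"
  shows "\<exists>h. v1 = h * a \<and> v2 = h * b \<and> v3 = h * c"
proof -
  have "a dvd v1 * a" "a dvd v1 * b" "a dvd v1 * c"
    using assms(3,4) by (metis dvd_triv_right, metis dvd_triv_left mult.commute,
        metis dvd_triv_left mult.commute)
  then have "a dvd v1 * gcd a (gcd b c)" by (intro dvd_mult_gcd)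
  then have "a dvd v1" using assms(1) by (simp add: dvd_mult_unit_iff)
  then obtain h where h: "v1 = a * h" by blast
  have "a * v2 = a * (h * b)" "a * v3 = a * (h * c)" using assms(3,4) h by (simp_all add: mult_ac)
  then show ?thesis using h assms(2) by (auto simp: mult.commute)
qed

text \<open>A vanishing cross product means proportionality over the fraction field, and primitivity
  makes the factor a polynomial. Cyclic symmetry allows any nonzero component to come first.\<close>

lemma parallel_to_primitive:
  fixes a b c :: cpoly3
  assumes gcd: "is_unit (gcd a (gcd b c))"
    and par: "b * v3 = c * v2" "c * v1 = a * v3" "a * v2 = b * v1"
  shows "\<exists>h. v1 = h * a \<and> v2 = h * b \<and> v3 = h * c"
proof -
  have gcd': "is_unit (gcd b (gcd c a))" "is_unit (gcd c (gcd a b))"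
    using gcd by (simp_all add: gcd.commute gcd.left_commute)
  have "a \<noteq> 0 \<or> b \<noteq> 0 \<or> c \<noteq> 0" using gcd by auto
  then consider "a \<noteq> 0" | "b \<noteq> 0" | "c \<noteq> 0" by blast
  then show ?thesis
  proof cases
    case 1
    then show ?thesis using parallel_to_primitive_aux[OF gcd, of v2 v1 v3] par by simp
  next
    case 2
    then show ?thesis using parallel_to_primitive_aux[OF gcd'(1), of v3 v2 v1] par by auto
  next
    case 3
    then show ?thesis using parallel_to_primitive_aux[OF gcd'(2), of v1 v3 v2] par by auto
  qed
qed

text \<open>By Euler's identity a common prime factor of the gradient divides f, and then so does
  its square.\<close>

lemma squarefree_gradient_primitive:
  assumes sqf: "squarefree f" and hf: "homog f (Suc d)"
  shows "is_unit (gcd (dx f) (gcd (dy f) (dz f)))"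
proof (rule gcd3_unit[OF homog_dx[OF hf] homog_dy[OF hf] homog_dz[OF hf]])
  fix p e assume p: "prime_elem p" "homog p e"
  show "\<not> (p dvd dx f \<and> p dvd dy f \<and> p dvd dz f)"
  proof
    assume *: "p dvd dx f \<and> p dvd dy f \<and> p dvd dz f"
    then have "p dvd of_nat (Suc d) * f" unfolding euler_homog[OF hf, symmetric] by simp
    then have "p dvd f" by (rule prime_dvd_of_nat_mult[OF p(1)]) simp
    then have "p ^ 2 dvd f" using prime_square_dvd[OF p] * by blast
    then show False using squarefreeD[OF sqf] p by (auto simp: prime_elem_def)
  qed
qed

theorem theorem1p8:
  fixes q :: "nat \<Rightarrow> cpoly3" and m k :: nat and f :: cpoly3
  assumes "m \<ge> 3" and "k \<ge> 2"
    and "\<forall>i\<in>{1..m}. q i \<noteq> 0 \<and> homog (q i) k"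
    and "f = (\<Prod>i\<in>{1..m}. q i)"
    and "squarefree f"
    and "\<forall>i\<in>{1..m}. \<exists>u v. (u, v) \<noteq> (0, 0) \<and> q i = const3 u * q 1 + const3 v * q 2"
    and "zero_dim_base_locus (q 1) (q 2)"
    and "\<forall>u v. (u, v) \<noteq> (0, 0) \<longrightarrow> squarefree (const3 u * q 1 + const3 v * q 2)"
  shows "mdr f = 2 * k - 2 \<or>
    (m = 3 \<and> mdr f \<le> 2 * k - 3 \<and>
      ((k \<ge> 4 \<and> mdr f \<le> k + 1 \<and> mdr f = k + 1 \<and> free_with_exponents f (k + 1) (2 * k - 2)) \<or>
       (k \<ge> 5 \<and> k + 2 \<le> mdr f \<and> mdr f \<le> 2 * k - 3)))"
proof (cases "mdr f = 2 * k - 2")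
  case False
  have hq: "homog (q 1) k" "homog (q 2) k" using assms(1,3) by auto
  obtain k' where k': "k = Suc k'" using assms(2) by (cases k) auto
  define X1 where "X1 = jac1 (q 1) (q 2)"
  define X2 where "X2 = jac2 (q 1) (q 2)"
  define X3 where "X3 = jac3 (q 1) (q 2)"
  note hq' = hq[unfolded k']
  have "homog X1 (k' + k')" "homog X2 (k' + k')" "homog X3 (k' + k')"
    unfolding X1_def X2_def X3_def jac1_def jac2_def jac3_def
    by (intro homog_diff homog_mult homog_dx homog_dy homog_dz hq')+
  then have hX: "homog X1 (2 * k - 2)" "homog X2 (2 * k - 2)" "homog X3 (2 * k - 2)"
    by (simp_all add: k' mult_2)
  \<comment> \<open>The product q 1 * q 2 divides the squarefree f, so no prime divides both
    factors.\<close>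
  have sub: "prod q {1, 2} dvd f" unfolding assms(4) using assms(1) by (intro prod_dvd_prod_subset) auto
  have coprime: "\<not> (p dvd q 1 \<and> p dvd q 2)" if "prime_elem p" for p
  proof
    assume "p dvd q 1 \<and> p dvd q 2"
    then have "p ^ 2 dvd prod q {1, 2}" by (auto simp: power2_eq_square intro: mult_dvd_mono)
    then have "p ^ 2 dvd f" using sub dvd_trans by blast
    then show False using squarefreeD[OF assms(5)] that by (auto simp: prime_elem_def)
  qed
  have gX: "is_unit (gcd X1 (gcd X2 X3))"
  proof (rule gcd3_unit[OF hX])
    fix p e assume p: "prime_elem p" "homog p e"
    show "\<not> (p dvd X1 \<and> p dvd X2 \<and> p dvd X3)"
      unfolding X1_def X2_def X3_def using assms(2,8) coprime[OF p(1)]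
      by (intro prime_not_dvd_jacobian[OF p hq]) auto
  qed
  then have X0: "X1 \<noteq> 0 \<or> X2 \<noteq> 0 \<or> X3 \<noteq> 0" by auto
  have hf: "homog f (m * k)"
    unfolding assms(4) using homog_prod[of "{1..m}" q k] assms(3) by simp
  have mk: "Suc (m * k - 1) = m * k" using assms(1,2) by simp
  have hf': "homog f (Suc (m * k - 1))" unfolding mk by (rule hf)
  note hdf = homog_dx[OF hf'] homog_dy[OF hf'] homog_dz[OF hf']
  have gf: "is_unit (gcd (dx f) (gcd (dy f) (dz f)))"
    by (rule squarefree_gradient_primitive[OF assms(5) hf'])
  \<comment> \<open>The derivative along X kills both generators, hence every q i and their product
    f.\<close>
  define D where "D h = X1 * dx h + X2 * dy h + X3 * dz h" for h
  have D: "derivation D" unfolding D_def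
    by (rule derivation_lin_comb[OF derivation_dx derivation_dy derivation_dz])
  have D12: "D (q 1) = 0" "D (q 2) = 0"
    by (simp_all add: D_def X1_def X2_def X3_def jac1_def jac2_def jac3_def algebra_simps)
  have Dc: "D (const3 c) = 0" for c by (simp add: D_def derivs_const3)
  have "D (q i) = 0" if i: "i \<in> {1..m}" for i
  proof -
    obtain u v where "q i = const3 u * q 1 + const3 v * q 2" using assms(6) i by blast
    then show ?thesis by (simp add: derivation_add[OF D] derivation_mult[OF D] Dc D12 del: One_nat_def)
  qed
  then have DX: "X1 * dx f + X2 * dy f + X3 * dz f = 0"
    using derivation_prod_0[OF D, of "{1..m}" q] by (simp add: assms(4) D_def)
  \<comment> \<open>Both syzygies are orthogonal to the gradient of f, so their cross product is
    proportional to it; the gradient is primitive.\<close>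
  have parallel: "\<exists>s. b * X3 - c * X2 = s * dx f \<and> c * X1 - a * X3 = s * dy f \<and> a * X2 - b * X1 = s * dz f"
    if "a * dx f + b * dy f + c * dz f = 0" for a b c
  proof (rule parallel_to_primitive[OF gf])
    have "dy f * (a * X2 - b * X1) - dz f * (c * X1 - a * X3)
        = a * (X1 * dx f + X2 * dy f + X3 * dz f) - X1 * (a * dx f + b * dy f + c * dz f)"
      by (simp add: algebra_simps)
    then show "dy f * (a * X2 - b * X1) = dz f * (c * X1 - a * X3)" using DX that by simp
    have "dz f * (b * X3 - c * X2) - dx f * (a * X2 - b * X1)
        = b * (X1 * dx f + X2 * dy f + X3 * dz f) - X2 * (a * dx f + b * dy f + c * dz f)"
      by (simp add: algebra_simps)
    then show "dz f * (b * X3 - c * X2) = dx f * (a * X2 - b * X1)" using DX that by simp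
    have "dx f * (c * X1 - a * X3) - dy f * (b * X3 - c * X2)
        = c * (X1 * dx f + X2 * dy f + X3 * dz f) - X3 * (a * dx f + b * dy f + c * dz f)"
      by (simp add: algebra_simps)
    then show "dx f * (c * X1 - a * X3) = dy f * (b * X3 - c * X2)" using DX that by simp
  qed
  have multiple: "\<exists>h. a = h * X1 \<and> b = h * X2 \<and> c = h * X3"
    if "b * X3 - c * X2 = 0" "c * X1 - a * X3 = 0" "a * X2 - b * X1 = 0" for a b c
    using that by (intro parallel_to_primitive[OF gX]) (simp_all add: mult.commute)
  define Q where "Q r \<longleftrightarrow> (\<exists>t. homog_triple t r \<and> t \<noteq> (0, 0, 0) \<and> syz f t)" for r
  have mdr: "mdr f = (LEAST r. Q r)" by (simp add: mdr_def Q_def)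
  have QX: "Q (2 * k - 2)" unfolding Q_def
    using hX X0 DX by (intro exI[of _ "(X1, X2, X3)"]) (auto simp: homog_triple_def syz_def)
  have le: "mdr f \<le> 2 * k - 2" unfolding mdr using QX by (rule Least_le)
  have "Q (mdr f)" unfolding mdr using QX by (rule LeastI)
  then obtain a b c where ht: "homog a (mdr f)" "homog b (mdr f)" "homog c (mdr f)"
    and t0: "(a, b, c) \<noteq> (0, 0, 0)" and st: "a * dx f + b * dy f + c * dz f = 0"
    by (auto simp: Q_def homog_triple_def syz_def)
  obtain s where s: "b * X3 - c * X2 = s * dx f" "c * X1 - a * X3 = s * dy f" "a * X2 - b * X1 = s * dz f"
    using parallel[OF st] by blast
  define n where "n = mdr f + (2 * k - 2)"
  \<comment> \<open>Otherwise the minimal syzygy would be a polynomial multiple of the primitive X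
    and have degree at least 2k - 2.\<close>
  have cross0: "s * dx f \<noteq> 0 \<or> s * dy f \<noteq> 0 \<or> s * dz f \<noteq> 0"
  proof (rule ccontr)
    assume "\<not> ?thesis"
    then obtain h where "a = h * X1 \<and> b = h * X2 \<and> c = h * X3"
      using multiple[of b c a] unfolding s by blast
    then have h: "a = X1 * h" "b = X2 * h" "c = X3 * h" by (simp_all add: mult.commute)
    have "2 * k - 2 \<le> mdr f"
      using homog_quotient(1) hX ht t0 unfolding h by blast
    then show False using le False by simp
  qed
  have "homog (b * X3 - c * X2) n" "homog (c * X1 - a * X3) n" "homog (a * X2 - b * X1) n"
    unfolding n_def by (intro homog_diff homog_mult ht hX)+
  then have hs: "homog (dx f * s) n" "homog (dy f * s) n" "homog (dz f * s) n"
    by (simp_all only: s mult.commute[of _ s])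
  from cross0 have deg: "m * k - 1 \<le> n" "homog s (n - (m * k - 1))"
    using homog_quotient[OF hs(1) hdf(1)] homog_quotient[OF hs(2) hdf(2)]
      homog_quotient[OF hs(3) hdf(3)] by (auto simp: mult.commute)
  have m3: "m = 3"
  proof (rule ccontr)
    assume "m \<noteq> 3"
    \<comment> \<open>For m at least 4 the degrees would give 4k - 1 \<le> n \<le> 4k - 4.\<close>
    then have "4 * k \<le> m * k" using assms(1) by (intro mult_right_mono) auto
    then show False using deg(1) le assms(2) unfolding n_def by linarith
  qed
  have r: "k + 1 \<le> mdr f" "mdr f \<le> 2 * k - 3"
    using deg(1) m3 assms(2) le False by (auto simp: n_def)
  show ?thesis
  proof (cases "mdr f = k + 1")
    case True
    have "n - (m * k - 1) = 0" using True m3 assms(2) by (simp add: n_def)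
    then have "s = const3 (coeff3 s 0 0 0)" using deg(2) homog_0_imp_const3 by simp
    then obtain s' where s': "s * s' = 1"
      using is_unit_const3[of "coeff3 s 0 0 0"] cross0 by (metis const3_0 dvdE mult_zero_left)
    have "\<exists>!p. r = tcomb (fst p) (a, b, c) (snd p) (X1, X2, X3)" if r: "syz f r" for r
    proof -
      obtain a' b' c' where r': "r = (a', b', c')" by (cases r)
      then have "a' * dx f + b' * dy f + c' * dz f = 0" using r by (simp add: syz_def)
      then obtain u where u: "b' * X3 - c' * X2 = u * dx f" "c' * X1 - a' * X3 = u * dy f"
        "a' * X2 - b' * X1 = u * dz f"
        using parallel by blast
      \<comment> \<open>\<alpha> is u / s, so that subtracting \<alpha> times the minimal syzygy
        from r leaves a vanishing cross product with X, hence a multiple of X.\<close>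
      define \<alpha> where "\<alpha> = s' * u"
      have \<alpha>s: "\<alpha> * (s * d) = u * d" for d
        using arg_cong[OF s', of "\<lambda>x. u * d * x"] by (simp add: \<alpha>_def mult_ac)
      have "(b' - \<alpha> * b) * X3 - (c' - \<alpha> * c) * X2 = (b' * X3 - c' * X2) - \<alpha> * (b * X3 - c * X2)"
        "(c' - \<alpha> * c) * X1 - (a' - \<alpha> * a) * X3 = (c' * X1 - a' * X3) - \<alpha> * (c * X1 - a * X3)"
        "(a' - \<alpha> * a) * X2 - (b' - \<alpha> * b) * X1 = (a' * X2 - b' * X1) - \<alpha> * (a * X2 - b * X1)"
        by (simp_all add: algebra_simps)
      then obtain \<beta> where \<beta>: "a' - \<alpha> * a = \<beta> * X1" "b' - \<alpha> * b = \<beta> * X2" "c' - \<alpha> * c = \<beta> * X3"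
        using multiple by (metis u s \<alpha>s diff_self)
      show ?thesis
      proof (rule ex1I[of _ "(\<alpha>, \<beta>)"])
        show "r = tcomb (fst (\<alpha>, \<beta>)) (a, b, c) (snd (\<alpha>, \<beta>)) (X1, X2, X3)"
          using \<beta> by (simp add: r' tcomb_def algebra_simps)
      next
        fix p assume p: "r = tcomb (fst p) (a, b, c) (snd p) (X1, X2, X3)"
        obtain x y where xy: "p = (x, y)" by (cases p)
        have e: "(\<alpha> - x) * a = (y - \<beta>) * X1" "(\<alpha> - x) * b = (y - \<beta>) * X2" "(\<alpha> - x) * c = (y - \<beta>) * X3"
          using p \<beta> by (simp_all add: r' xy tcomb_def algebra_simps)
        \<comment> \<open>Taking the cross product of the identities \<open>e\<close> with X removes
          y - \<beta> and leaves (\<alpha> - x) s times the gradient of f.\<close>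
        have "(\<alpha> - x) * (b * X3 - c * X2) = ((\<alpha> - x) * b) * X3 - ((\<alpha> - x) * c) * X2"
          "(\<alpha> - x) * (c * X1 - a * X3) = ((\<alpha> - x) * c) * X1 - ((\<alpha> - x) * a) * X3"
          "(\<alpha> - x) * (a * X2 - b * X1) = ((\<alpha> - x) * a) * X2 - ((\<alpha> - x) * b) * X1"
          by (simp_all only: right_diff_distrib mult.assoc)
        then have "(\<alpha> - x) * (s * dx f) = 0" "(\<alpha> - x) * (s * dy f) = 0" "(\<alpha> - x) * (s * dz f) = 0"
          unfolding e s by (simp_all add: mult_ac)
        then have "x = \<alpha>" using cross0 by auto
        moreover from this have "y = \<beta>" using e X0 by auto
        ultimately show "p = (\<alpha>, \<beta>)" by (simp add: xy)
      qed
    qed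
    then have "free_with_exponents f (k + 1) (2 * k - 2)"
      unfolding free_with_exponents_def using ht hX st DX True
      by (intro exI[of _ "(a, b, c)"] exI[of _ "(X1, X2, X3)"]) (auto simp: homog_triple_def syz_def)
    moreover have "k \<ge> 4" using True r assms(2) by linarith
    ultimately show ?thesis using True r m3 by simp
  next
    case False
    \<comment> \<open>Here k + 2 \<le> mdr f \<le> 2k - 3, which forces k \<ge> 5.\<close>
    then show ?thesis using r m3 by linarith
  qed
qed simp

end
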